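(* Let $Q$ be a quiver of type $A_n$ with vertices $1,\dots,n$ and intrinsic weight system $\Theta=(\theta_i)_{1\le i\le n}$. For $1\le p\le q\le n$ let $\Theta(I_{p,q})\in\mathbb{Z}^n$ and $\Theta'(I_{p,q})\in\mathbb{Z}^n$ be the weight systems attached to the indecomposable representation $I_{p,q}$ that are defined in the context. Then: (a) There exist non-negative integers $c(I_{p,q})$ such that $$\Theta=\sum_{1\le p\le q\le n}c(I_{p,q})\,\Theta(I_{p,q}).$$ Moreover, the sum can be taken over only those $I_{p,q}$ satisfying all of the following: if $p\ne 1$ and $p$ is a vertex of type I or IV, then either $q=n$, or $q\neq n$ and $q$ is of type II or IV; if $p$ is a vertex of type II or III, then $q\neq n$ and $q$ is of type I or III; if $p=1$, then $q\ne n$ and $q$ is of type I or III. (b) There exist non-negative integers $c'(I_{p,q})$ such that $$\Theta=\sum_{1\le p\le q\le n}c'(I_{p,q})\,\Theta'(I_{p,q}).$$ Moreover, the sum can be taken over only those $I_{p,q}$ satisfying all of the following: if $p\ne1$ and $p$ is a vertex of type II or III, then either $q=n$, or $q\ne n$ and $q$ is of type I or III; if $p$ is a vertex of type I or IV, then $q\ne n$ and $q$ is of type II or IV; if $p=1$, then $q\neq n$ and $q$ is of type II or IV.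
   Context: A quiver of type $A_n$ is a quiver whose underlying graph is a chain of $n$ vertices, consecutive vertices being joined by exactly one arrow of arbitrary orientation. Draw it horizontally and number the vertices $1,\dots,n$ from left to right. Types of vertices: $i$ is of type I if every arrow attached to $i$ starts at $i$; of type II if every arrow attached to $i$ terminates at $i$; of type III if $i$ is an interior vertex of a left-to-right path, i.e. $i-1\to i\to i+1$; of type IV if $i$ is an interior vertex of a right-to-left path, i.e. $i-1\leftarrow i\leftarrow i+1$. Intrinsic weight system $\Theta=(\theta_i)$: let $l_i=i-1$ and $r_i=n-i$ be the numbers of vertices to the left and right of $i$. Then $\theta_i=l_i+r_i+2l_ir_i$ if $i$ is of type I; $\theta_i=-l_i-r_i-2l_ir_i$ if $i$ is of type II; $\theta_i=r_i-l_i$ if $i$ is of type III; $\theta_i=l_i-r_i$ if $i$ is of type IV. $I_{p,q}$ ($1\le p\le q\le n$) is the indecomposable representation over the algebraically closed field $k$ with $k$ at each vertex $i$ with $p\le i\le q$, $0$ at all other vertices, identity maps on arrows between vertices in $\{p,\dots,q\}$ and zero maps on all other arrows; these are all the indecomposable representations of $Q$ up to isomorphism. The weight system $\Theta(I_{p,q})$ has $i$-th entry: - for $p<i<q$: $1$ if $i$ is of type I, $-1$ if of type II, $0$ if of type III or IV; - for $i=p=q$: $1$; - for $i=p<q$: $1$ if $i$ is of type I or III, $0$ if of type II or IV; - for $i=q>p$: $1$ if $i$ is of type I or IV, $0$ if of type II or III; - for $i=p-1$: $0$ if $i$ is of type I or III, $-1$ if of type II or IV; - for $i=q+1$: $0$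 if $i$ is of type I or IV, $-1$ if of type II or III; - for $i<p-1$ or $i>q+1$: $0$. The weight system $\Theta'(I_{p,q})$ has $i$-th entry: - for $p<i<q$: $1$ if $i$ is of type I, $-1$ if of type II, $0$ if of type III or IV; - for $i=p=q$: $-1$; - for $i=p<q$: $-1$ if $i$ is of type II or IV, $0$ if of type I or III; - for $i=q>p$: $-1$ if $i$ is of type II or III, $0$ if of type I or IV; - for $i=p-1$: $1$ if $i$ is of type I or III, $0$ if of type II or IV; - for $i=q+1$: $1$ if $i$ is of type I or IV, $0$ if of type II or III; - for $i<p-1$ or $i>q+1$: $0$. *)

theory Defs
  imports Graph_Theory.Digraph
begin

text \<open>
  A quiver is a directed multigraph, that is, a \<^type>\<open>pre_digraph\<close> satisfying
  \<^locale>\<open>wf_digraph\<close>. A quiver of type \<open>A\<^sub>n\<close> has the vertices \<open>1, \<dots>, n\<close>, numbered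
  along the chain; its arrows may be oriented arbitrarily and may be of any type.
\<close>

definition type_A_quiver :: "nat \<Rightarrow> (nat, 'b) pre_digraph \<Rightarrow> bool" where
  "type_A_quiver n Q \<longleftrightarrow>
     1 \<le> n \<and> wf_digraph Q \<and> verts Q = {1..n} \<and>
     (\<forall>a \<in> arcs Q. \<exists>i. 1 \<le> i \<and> i < n \<and> {tail Q a, head Q a} = {i, i + 1}) \<and>
     (\<forall>i. 1 \<le> i \<and> i < n \<longrightarrow> (\<exists>!a. a \<in> arcs Q \<and> {tail Q a, head Q a} = {i, i + 1}))"

text \<open>
  The only overlap between the four vertex types occurs for \<open>n = 1\<close>, where the single
  vertex is both of type I and of type II; both formulas for its intrinsic weight give 0.
\<close>

definition type_I :: "(nat, 'b) pre_digraph \<Rightarrow> nat \<Rightarrow> bool" where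
  "type_I Q i \<longleftrightarrow> i \<in> verts Q \<and>
     (\<forall>a \<in> arcs Q. i = tail Q a \<or> i = head Q a \<longrightarrow> tail Q a = i)"

definition type_II :: "(nat, 'b) pre_digraph \<Rightarrow> nat \<Rightarrow> bool" where
  "type_II Q i \<longleftrightarrow> i \<in> verts Q \<and>
     (\<forall>a \<in> arcs Q. i = tail Q a \<or> i = head Q a \<longrightarrow> head Q a = i)"

definition type_III :: "(nat, 'b) pre_digraph \<Rightarrow> nat \<Rightarrow> bool" where
  "type_III Q i \<longleftrightarrow> (i - 1) \<rightarrow>\<^bsub>Q\<^esub> i \<and> i \<rightarrow>\<^bsub>Q\<^esub> (i + 1)"

definition type_IV :: "(nat, 'b) pre_digraph \<Rightarrow> nat \<Rightarrow> bool" where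
  "type_IV Q i \<longleftrightarrow> (i + 1) \<rightarrow>\<^bsub>Q\<^esub> i \<and> i \<rightarrow>\<^bsub>Q\<^esub> (i - 1)"

text \<open>Weight systems are functions on \<^typ>\<open>nat\<close>; only the entries at \<open>1, \<dots>, n\<close> matter.\<close>

definition intrinsic_weight :: "nat \<Rightarrow> (nat, 'b) pre_digraph \<Rightarrow> nat \<Rightarrow> int" where
  "intrinsic_weight n Q i =
     (let l = int i - 1; r = int n - int i in
      if type_I Q i then l + r + 2 * l * r
      else if type_II Q i then - l - r - 2 * l * r
      else if type_III Q i then r - l
      else if type_IV Q i then l - r
      else 0)"

text \<open>
  The weight systems \<open>\<Theta>(I\<^sub>p\<^sub>,\<^sub>q)\<close> and \<open>\<Theta>'(I\<^sub>p\<^sub>,\<^sub>q)\<close> for \<open>p \<le> q\<close>. The indecomposable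
  representation \<open>I\<^sub>p\<^sub>,\<^sub>q\<close> with support \<open>{p..q}\<close> enters only through \<open>p\<close> and \<open>q\<close>.
\<close>

definition interval_weight :: "(nat, 'b) pre_digraph \<Rightarrow> nat \<Rightarrow> nat \<Rightarrow> nat \<Rightarrow> int" where
  "interval_weight Q p q i =
     (if p < i \<and> i < q then (if type_I Q i then 1 else if type_II Q i then - 1 else 0)
      else if i = p \<and> p = q then 1
      else if i = p \<and> p < q then (if type_I Q i \<or> type_III Q i then 1 else 0)
      else if i = q \<and> p < q then (if type_I Q i \<or> type_IV Q i then 1 else 0)
      else if i + 1 = p then (if type_II Q i \<or> type_IV Q i then - 1 else 0)
      else if i = q + 1 then (if type_II Q i \<or> type_III Q i then - 1 else 0)
      else 0)"

definition interval_weight' :: "(nat, 'b) pre_digraph \<Rightarrow> nat \<Rightarrow> nat \<Rightarrow> nat \<Rightarrow> int" where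
  "interval_weight' Q p q i =
     (if p < i \<and> i < q then (if type_I Q i then 1 else if type_II Q i then - 1 else 0)
      else if i = p \<and> p = q then - 1
      else if i = p \<and> p < q then (if type_II Q i \<or> type_IV Q i then - 1 else 0)
      else if i = q \<and> p < q then (if type_II Q i \<or> type_III Q i then - 1 else 0)
      else if i + 1 = p then (if type_I Q i \<or> type_III Q i then 1 else 0)
      else if i = q + 1 then (if type_I Q i \<or> type_IV Q i then 1 else 0)
      else 0)"

definition intervals :: "nat \<Rightarrow> (nat \<times> nat) set" where
  "intervals n = {(p, q). 1 \<le> p \<and> p \<le> q \<and> q \<le> n}"

definition admissible :: "nat \<Rightarrow> (nat, 'b) pre_digraph \<Rightarrow> nat \<Rightarrow> nat \<Rightarrow> bool" where
  "admissible n Q p q \<longleftrightarrow>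
     (p \<noteq> 1 \<and> (type_I Q p \<or> type_IV Q p) \<longrightarrow>
        q = n \<or> q \<noteq> n \<and> (type_II Q q \<or> type_IV Q q)) \<and>
     (type_II Q p \<or> type_III Q p \<longrightarrow> q \<noteq> n \<and> (type_I Q q \<or> type_III Q q)) \<and>
     (p = 1 \<longrightarrow> q \<noteq> n \<and> (type_I Q q \<or> type_III Q q))"

definition admissible' :: "nat \<Rightarrow> (nat, 'b) pre_digraph \<Rightarrow> nat \<Rightarrow> nat \<Rightarrow> bool" where
  "admissible' n Q p q \<longleftrightarrow>
     (p \<noteq> 1 \<and> (type_II Q p \<or> type_III Q p) \<longrightarrow>
        q = n \<or> q \<noteq> n \<and> (type_I Q q \<or> type_III Q q)) \<and>
     (type_I Q p \<or> type_IV Q p \<longrightarrow> q \<noteq> n \<and> (type_II Q q \<or> type_IV Q q)) \<and>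
     (p = 1 \<longrightarrow> q \<noteq> n \<and> (type_II Q q \<or> type_IV Q q))"

end

theory Submission
  imports Defs
begin

text \<open>
  Removing the arrow between \<open>j\<close> and \<open>j + 1\<close> cuts the chain into pieces with \<open>j\<close> and \<open>n - j\<close>
  vertices. The intrinsic weight system is a sum over the arrows,
  \<open>\<Theta> = (\<Sum>j=1..<n. j * (n - j) * (\<delta>\<^sub>t - \<delta>\<^sub>h))\<close>, where \<open>t\<close> and \<open>h\<close> are the tail and the head of the
  arrow between \<open>j\<close> and \<open>j + 1\<close> (\<open>intrinsic_weight_eq_sum_arrows\<close>): with \<open>l = i - 1\<close> and
  \<open>r = n - i\<close>, the two arrows at \<open>i\<close> have coefficients \<open>l * (r + 1)\<close> and \<open>(l + 1) * r\<close>, whose sum is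
  \<open>l + r + 2 * l * r\<close> and whose difference is \<open>r - l\<close>.

  For each arrow, \<open>\<delta>\<^sub>t - \<delta>\<^sub>h\<close> is itself the weight system of a single indecomposable. The
  reason is that \<open>\<Theta>(I\<^sub>p\<^sub>,\<^sub>q)\<close> at \<open>i\<close> is the dimension of \<open>I\<^sub>p\<^sub>,\<^sub>q\<close> at \<open>i\<close> minus its dimensions at
  the tails of the arrows that end at \<open>i\<close> (\<open>interval_weight_eq\<close>). Take as support the longest
  oriented path that starts at \<open>t\<close> and does not use the given arrow. Every vertex of this path
  other than \<open>t\<close> is the head of exactly one arrow with its tail in the support, so its entry is
  \<open>1 - 1 = 0\<close>; no such arrow ends at \<open>t\<close>, which leaves \<open>1\<close>; and \<open>h\<close>, which lies outside the
  support, gets \<open>-1\<close>. The neighbour of the support at the far end of the path gets \<open>0\<close>, because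
  by maximality the arrow there points into the support. The directions of these two arrows next to
  the support force the types of its end points that admissibility demands
  (\<open>arrow_weight_eq_interval_weight\<close>). This proves
  the first half: \<open>c(I\<^sub>p\<^sub>,\<^sub>q)\<close> is the sum of \<open>j * (n - j)\<close> over the arrows whose path has support
  \<open>{p..q}\<close>.

  Reversing all arrows exchanges types I and II as well as III and IV. It therefore negates \<open>\<Theta>\<close>,
  turns \<open>\<Theta>(I\<^sub>p\<^sub>,\<^sub>q)\<close> into \<open>- \<Theta>'(I\<^sub>p\<^sub>,\<^sub>q)\<close>, and carries one admissibility condition into the other.
  Hence the second half is the first half for the opposite quiver.
\<close>

section \<open>Arrows and vertex types\<close>

lemma arrow_cases:
  assumes "type_A_quiver n Q" "u \<rightarrow>\<^bsub>Q\<^esub> v"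
  obtains j where "1 \<le> j" "j < n" "u = j" "v = Suc j" | j where "1 \<le> j" "j < n" "u = Suc j" "v = j"
proof -
  obtain a where a: "a \<in> arcs Q" "tail Q a = u" "head Q a = v"
    using assms(2) by (auto simp: arcs_ends_conv)
  then obtain j where "1 \<le> j" "j < n" "{u, v} = {j, j + 1}"
    using assms(1) unfolding type_A_quiver_def by metis
  then show thesis
    using that by (auto simp: doubleton_eq_iff)
qed

lemma leftward_iff:
  assumes "type_A_quiver n Q" "1 \<le> j" "j < n"
  shows "Suc j \<rightarrow>\<^bsub>Q\<^esub> j \<longleftrightarrow> \<not> j \<rightarrow>\<^bsub>Q\<^esub> Suc j"
proof -
  have ex1: "\<exists>!a. a \<in> arcs Q \<and> {tail Q a, head Q a} = {j, Suc j}"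
    using assms unfolding type_A_quiver_def by simp
  then obtain a where a: "a \<in> arcs Q" "{tail Q a, head Q a} = {j, Suc j}" by blast
  have "Suc j \<rightarrow>\<^bsub>Q\<^esub> j \<or> j \<rightarrow>\<^bsub>Q\<^esub> Suc j"
  proof -
    have "tail Q a \<rightarrow>\<^bsub>Q\<^esub> head Q a"
      using a(1) by (auto simp: arcs_ends_conv)
    then show ?thesis
      using a(2) by (auto simp: doubleton_eq_iff)
  qed
  moreover have "\<not> (Suc j \<rightarrow>\<^bsub>Q\<^esub> j \<and> j \<rightarrow>\<^bsub>Q\<^esub> Suc j)"
  proof
    assume "Suc j \<rightarrow>\<^bsub>Q\<^esub> j \<and> j \<rightarrow>\<^bsub>Q\<^esub> Suc j"
    then obtain b c where "b \<in> arcs Q" "tail Q b = Suc j" "head Q b = j"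
      "c \<in> arcs Q" "tail Q c = j" "head Q c = Suc j"
      by (auto simp: arcs_ends_conv)
    with ex1 have "b = c" by (metis insert_commute)
    with \<open>tail Q b = Suc j\<close> \<open>tail Q c = j\<close> show False by simp
  qed
  ultimately show ?thesis by blast
qed

text \<open>
  By these equivalences the directions \<open>j \<rightarrow> Suc j\<close> for \<open>1 \<le> j < n\<close> determine all types. The end
  points of the chain are covered too: with only one arrow attached (or none, if \<open>n = 1\<close>), the
  condition on the missing side is vacuous for types I and II and fails for types III and IV.
\<close>

lemma type_iff:
  assumes Q: "type_A_quiver n Q" and i: "1 \<le> i" "i \<le> n"
  shows type_I_iff: "type_I Q i \<longleftrightarrow>
      (1 < i \<longrightarrow> \<not> (i - 1) \<rightarrow>\<^bsub>Q\<^esub> i) \<and> (i < n \<longrightarrow> i \<rightarrow>\<^bsub>Q\<^esub> Suc i)"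
    and type_II_iff: "type_II Q i \<longleftrightarrow>
      (1 < i \<longrightarrow> (i - 1) \<rightarrow>\<^bsub>Q\<^esub> i) \<and> (i < n \<longrightarrow> \<not> i \<rightarrow>\<^bsub>Q\<^esub> Suc i)"
    and type_III_iff: "type_III Q i \<longleftrightarrow>
      1 < i \<and> i < n \<and> (i - 1) \<rightarrow>\<^bsub>Q\<^esub> i \<and> i \<rightarrow>\<^bsub>Q\<^esub> Suc i"
    and type_IV_iff: "type_IV Q i \<longleftrightarrow>
      1 < i \<and> i < n \<and> \<not> (i - 1) \<rightarrow>\<^bsub>Q\<^esub> i \<and> \<not> i \<rightarrow>\<^bsub>Q\<^esub> Suc i"
proof -
  have verts: "i \<in> verts Q"
    using assms by (auto simp: type_A_quiver_def)
  have no_loop: "\<not> u \<rightarrow>\<^bsub>Q\<^esub> u" for u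
    using Q by (auto elim: arrow_cases)
  have left: "i \<rightarrow>\<^bsub>Q\<^esub> (i - 1) \<longleftrightarrow> \<not> (i - 1) \<rightarrow>\<^bsub>Q\<^esub> i" if "1 < i"
    using leftward_iff[OF Q, of "i - 1"] that i by simp
  have right: "Suc i \<rightarrow>\<^bsub>Q\<^esub> i \<longleftrightarrow> \<not> i \<rightarrow>\<^bsub>Q\<^esub> Suc i" if "i < n"
    using leftward_iff[OF Q, of i] that i by simp
  have adjacent: "v = u - 1 \<or> v = Suc u" "u = v - 1 \<or> u = Suc v" if "u \<rightarrow>\<^bsub>Q\<^esub> v" for u v
    using arrow_cases[OF Q that] by force+
  have bounds: "1 < i" if "(i - 1) \<rightarrow>\<^bsub>Q\<^esub> i \<or> i \<rightarrow>\<^bsub>Q\<^esub> (i - 1)"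
    using that by (auto elim!: arrow_cases[OF Q])
  have bounds': "i < n" if "i \<rightarrow>\<^bsub>Q\<^esub> Suc i \<or> Suc i \<rightarrow>\<^bsub>Q\<^esub> i"
    using that by (auto elim!: arrow_cases[OF Q])
  have "type_I Q i \<longleftrightarrow> (\<forall>u. \<not> u \<rightarrow>\<^bsub>Q\<^esub> i)"
    using verts no_loop unfolding type_I_def arcs_ends_conv by (fastforce simp: image_iff)
  also have "\<dots> \<longleftrightarrow> \<not> (i - 1) \<rightarrow>\<^bsub>Q\<^esub> i \<and> \<not> Suc i \<rightarrow>\<^bsub>Q\<^esub> i"
    using adjacent(2) by blast
  finally show "type_I Q i \<longleftrightarrow>
      (1 < i \<longrightarrow> \<not> (i - 1) \<rightarrow>\<^bsub>Q\<^esub> i) \<and> (i < n \<longrightarrow> i \<rightarrow>\<^bsub>Q\<^esub> Suc i)"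
    using bounds bounds' right by blast
  have "type_II Q i \<longleftrightarrow> (\<forall>u. \<not> i \<rightarrow>\<^bsub>Q\<^esub> u)"
    using verts no_loop unfolding type_II_def arcs_ends_conv by (fastforce simp: image_iff)
  also have "\<dots> \<longleftrightarrow> \<not> i \<rightarrow>\<^bsub>Q\<^esub> (i - 1) \<and> \<not> i \<rightarrow>\<^bsub>Q\<^esub> Suc i"
    using adjacent(1) by blast
  finally show "type_II Q i \<longleftrightarrow>
      (1 < i \<longrightarrow> (i - 1) \<rightarrow>\<^bsub>Q\<^esub> i) \<and> (i < n \<longrightarrow> \<not> i \<rightarrow>\<^bsub>Q\<^esub> Suc i)"
    using bounds bounds' left by blast
  show "type_III Q i \<longleftrightarrow> 1 < i \<and> i < n \<and> (i - 1) \<rightarrow>\<^bsub>Q\<^esub> i \<and> i \<rightarrow>\<^bsub>Q\<^esub> Suc i"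
    using bounds bounds' by (auto simp: type_III_def)
  show "type_IV Q i \<longleftrightarrow> 1 < i \<and> i < n \<and> \<not> (i - 1) \<rightarrow>\<^bsub>Q\<^esub> i \<and> \<not> i \<rightarrow>\<^bsub>Q\<^esub> Suc i"
    using bounds bounds' left right unfolding type_IV_def by auto
qed

section \<open>The intrinsic weight system as a sum over the arrows\<close>

text \<open>
  This is \<open>\<delta>\<^sub>t - \<delta>\<^sub>h\<close> for the tail \<open>t\<close> and the head \<open>h\<close> of the arrow between \<open>j\<close> and \<open>Suc j\<close>.
\<close>

definition arrow_weight :: "(nat, 'b) pre_digraph \<Rightarrow> nat \<Rightarrow> nat \<Rightarrow> int" where
  "arrow_weight Q j i =
     (if j \<rightarrow>\<^bsub>Q\<^esub> Suc j then of_bool (i = j) - of_bool (i = Suc j)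
      else of_bool (i = Suc j) - of_bool (i = j))"

text \<open>
  Only the arrows with \<open>j = i\<close> and \<open>j = i - 1\<close> touch \<open>i\<close>. In terms of \<open>l\<close> and \<open>r\<close> their coefficients
  are \<open>(l + 1) * r\<close> and \<open>l * (r + 1)\<close>, counted positively if the arrow leaves \<open>i\<close> and negatively if it
  enters \<open>i\<close>. At an end of the chain the coefficient of the missing arrow vanishes, so that the
  formulas for interior vertices persist.
\<close>

lemma intrinsic_weight_eq_sum_arrows:
  assumes Q: "type_A_quiver n Q" and i: "1 \<le> i" "i \<le> n"
  shows "intrinsic_weight n Q i = (\<Sum>j=1..<n. int (j * (n - j)) * arrow_weight Q j i)"
proof -
  have split: "int (j * (n - j)) * arrow_weight Q j i =
      (if i = j then int (j * (n - j)) * (if j \<rightarrow>\<^bsub>Q\<^esub> Suc j then 1 else - 1) else 0) +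
      (if i - 1 = j then int (j * (n - j)) * (if j \<rightarrow>\<^bsub>Q\<^esub> Suc j then - 1 else 1) else 0)"
    if "j \<in> {1..<n}" for j
    using i that by (auto simp: arrow_weight_def)
  have "(\<Sum>j=1..<n. int (j * (n - j)) * arrow_weight Q j i) =
      (if i < n then int (i * (n - i)) * (if i \<rightarrow>\<^bsub>Q\<^esub> Suc i then 1 else - 1) else 0) +
      (if 1 < i then int ((i - 1) * (n - (i - 1))) * (if (i - 1) \<rightarrow>\<^bsub>Q\<^esub> i then - 1 else 1) else 0)"
    using i by (subst sum.cong[OF refl split])
      (auto simp: sum.distrib sum.delta simp del: of_nat_mult)
  also have "int (i * (n - i)) = int i * (int n - int i)"
    using i by (simp add: of_nat_diff)
  also have "int ((i - 1) * (n - (i - 1))) = (int i - 1) * (int n - int i + 1)"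
    using i by (simp add: of_nat_diff)
  finally show ?thesis
    using i unfolding intrinsic_weight_def Let_def type_I_iff[OF Q i] type_II_iff[OF Q i]
      type_III_iff[OF Q i] type_IV_iff[OF Q i]
    by (elim ssubst) (cases "i = 1"; cases "i = n"; auto simp: algebra_simps)
qed

section \<open>Arrows as weight systems of indecomposables\<close>

text \<open>
  The case distinction in the weight system of \<open>I\<^sub>p\<^sub>,\<^sub>q\<close> comes from one formula: with
  \<open>d\<close> its dimension vector, the weight at \<open>i\<close> is \<open>d i\<close> minus the sum of \<open>d u\<close> over all arrows
  \<open>u \<rightarrow> i\<close>. This is the Euler form of \<open>I\<^sub>p\<^sub>,\<^sub>q\<close> against the simple representation at \<open>i\<close>.
  The last term stands for the arrow \<open>Suc i \<rightarrow> i\<close>; at \<open>i = n\<close>, where no such arrow exists, it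
  vanishes because of \<open>q \<le> n\<close>.
\<close>

lemma interval_weight_eq:
  assumes Q: "type_A_quiver n Q" and i: "1 \<le> i" "i \<le> n" and pq: "1 \<le> p" "p \<le> q" "q \<le> n"
  shows "interval_weight Q p q i =
     of_bool (p \<le> i \<and> i \<le> q)
     - of_bool (p \<le> i - 1 \<and> i - 1 \<le> q \<and> 1 < i \<and> (i - 1) \<rightarrow>\<^bsub>Q\<^esub> i)
     - of_bool (p \<le> Suc i \<and> Suc i \<le> q \<and> \<not> i \<rightarrow>\<^bsub>Q\<^esub> Suc i)"
proof -
  consider "p < i" "i < q" | "i = p" "p = q" | "i = p" "p < q" | "i = q" "p < q"
    | "i + 1 = p" | "i = q + 1" | "i + 1 < p" | "q + 1 < i"
    using pq by linarith
  then show ?thesis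
    using i pq unfolding interval_weight_def type_I_iff[OF Q i] type_II_iff[OF Q i]
      type_III_iff[OF Q i] type_IV_iff[OF Q i]
    by cases auto
qed

lemma ex_longest_left:
  assumes "1 \<le> (j::nat)"
  shows "\<exists>p. 1 \<le> p \<and> p \<le> j \<and> (\<forall>k. p \<le> k \<and> k < j \<longrightarrow> P k) \<and> (p = 1 \<or> \<not> P (p - 1))"
  using assms
proof (induction j rule: nat_induct_at_least)
  case base
  then show ?case by auto
next
  case (Suc j)
  then obtain p where p: "1 \<le> p" "p \<le> j" "\<forall>k. p \<le> k \<and> k < j \<longrightarrow> P k" "p = 1 \<or> \<not> P (p - 1)"
    by blast
  show ?case
  proof (cases "P j")
    case True
    with p show ?thesis by (intro exI[of _ p]) (auto simp: less_Suc_eq)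
  next
    case False
    then show ?thesis by (intro exI[of _ "Suc j"]) auto
  qed
qed

lemma ex_longest_right:
  assumes "m \<le> (n::nat)"
  shows "\<exists>q. m \<le> q \<and> q \<le> n \<and> (\<forall>k. m \<le> k \<and> k < q \<longrightarrow> P k) \<and> (q = n \<or> \<not> P q)"
  using assms
proof (induction m rule: inc_induct)
  case base
  then show ?case by auto
next
  case (step m)
  then obtain q where q: "Suc m \<le> q" "q \<le> n" "\<forall>k. Suc m \<le> k \<and> k < q \<longrightarrow> P k" "q = n \<or> \<not> P q"
    by blast
  show ?case
  proof (cases "P m")
    case True
    with q have "\<forall>k. m \<le> k \<and> k < q \<longrightarrow> P k"
      by (metis le_eq_less_or_eq Suc_leI)
    with q show ?thesis by (intro exI[of _ q]) auto
  next
    case False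
    with step.hyps show ?thesis by (intro exI[of _ m]) auto
  qed
qed

text \<open>
  The support consists of the tail of the arrow and of the longest oriented path that leaves the tail
  away from the head. For \<open>j \<rightarrow> Suc j\<close> it is \<open>p \<leftarrow> \<dots> \<leftarrow> j\<close>; here \<open>j\<close> is of type I or III because
  the arrow leaves it to the right, and \<open>p\<close>, where the path cannot be continued, is \<open>1\<close> or is entered
  from the left and hence of type II or III. For \<open>j \<leftarrow> Suc j\<close> it is \<open>Suc j \<rightarrow> \<dots> \<rightarrow> q\<close>, with the
  mirror images of these statements.
\<close>

lemma arrow_weight_eq_interval_weight:
  assumes Q: "type_A_quiver n Q" and j: "1 \<le> j" "j < n"
  shows "\<exists>p q. (p, q) \<in> intervals n \<and> admissible n Q p q \<and>
     (\<forall>i\<in>{1..n}. arrow_weight Q j i = interval_weight Q p q i)"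
proof (cases "j \<rightarrow>\<^bsub>Q\<^esub> Suc j")
  case True
  obtain p where p: "1 \<le> p" "p \<le> j" and path: "\<forall>k. p \<le> k \<and> k < j \<longrightarrow> \<not> k \<rightarrow>\<^bsub>Q\<^esub> Suc k"
    and maximal: "p = 1 \<or> (p - 1) \<rightarrow>\<^bsub>Q\<^esub> Suc (p - 1)"
    using ex_longest_left[OF j(1), of "\<lambda>k. \<not> k \<rightarrow>\<^bsub>Q\<^esub> Suc k"] by auto
  have "admissible n Q p j"
    using p j maximal True
    by (auto simp: admissible_def type_I_iff[OF Q] type_II_iff[OF Q] type_III_iff[OF Q]
      type_IV_iff[OF Q])
  moreover have "arrow_weight Q j i = interval_weight Q p j i" if "i \<in> {1..n}" for i
  proof -
    have i: "1 \<le> i" "i \<le> n" using that by auto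
    (* Inside the support the arrows point to the left, so each of p, ..., j - 1
       is entered from the support once, which cancels its dimension. *)
    have inside: "\<not> (i - 1) \<rightarrow>\<^bsub>Q\<^esub> i" if "p < i" "i \<le> j"
      using path that by (cases i) auto
    consider "Suc i < p" | "Suc i = p" | "i = p" "p = j" | "i = p" "p < j" | "p < i" "i < j"
      | "p < i" "i = j" | "i = Suc j" | "Suc j < i"
      using p by linarith
    then show ?thesis
      using p j i maximal path True inside
      by cases (auto simp: arrow_weight_def interval_weight_eq[OF Q])
  qed
  ultimately show ?thesis
    using p j by (intro exI[of _ p] exI[of _ j]) (auto simp: intervals_def)
next
  case False
  obtain q where q: "Suc j \<le> q" "q \<le> n" and path: "\<forall>k. Suc j \<le> k \<and> k < q \<longrightarrow> k \<rightarrow>\<^bsub>Q\<^esub> Suc k"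
    and maximal: "q = n \<or> \<not> q \<rightarrow>\<^bsub>Q\<^esub> Suc q"
    using ex_longest_right[of "Suc j" n "\<lambda>k. k \<rightarrow>\<^bsub>Q\<^esub> Suc k"] j by auto
  have "admissible n Q (Suc j) q"
    using q j maximal False
    by (auto simp: admissible_def type_I_iff[OF Q] type_II_iff[OF Q] type_III_iff[OF Q]
      type_IV_iff[OF Q])
  moreover have "arrow_weight Q j i = interval_weight Q (Suc j) q i" if "i \<in> {1..n}" for i
  proof -
    have i: "1 \<le> i" "i \<le> n" using that by auto
    have inside: "(i - 1) \<rightarrow>\<^bsub>Q\<^esub> i" if "Suc j < i" "i \<le> q"
      using path that by (cases i) auto
    consider "i < j" | "i = j" | "i = Suc j" "Suc j = q" | "i = Suc j" "Suc j < q"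
      | "Suc j < i" "i < q" | "Suc j < i" "i = q" | "i = Suc q" | "Suc q < i"
      using q by linarith
    then show ?thesis
      using q j i maximal path False inside
      by cases (auto simp: arrow_weight_def interval_weight_eq[OF Q])
  qed
  ultimately show ?thesis
    using q j by (intro exI[of _ "Suc j"] exI[of _ q]) (auto simp: intervals_def)
qed

lemma finite_intervals [simp]: "finite (intervals n)"
  by (rule finite_subset[of _ "{..n} \<times> {..n}"]) (auto simp: intervals_def)

text \<open>
  Grouping the arrows by their intervals turns the sum over the arrows into one over the intervals. An
  interval to which no arrow leads gets the coefficient \<open>0\<close>; this includes all that are not
  admissible.
\<close>

lemma intrinsic_weight_eq_sum_interval_weight:
  assumes Q: "type_A_quiver n Q"
  obtains c :: "nat \<times> nat \<Rightarrow> nat" where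
    "\<And>i. i \<in> {1..n} \<Longrightarrow> intrinsic_weight n Q i =
       (\<Sum>(p, q)\<in>intervals n. int (c (p, q)) * interval_weight Q p q i)"
    "\<And>p q. \<not> admissible n Q p q \<Longrightarrow> c (p, q) = 0"
proof -
  have "\<forall>j\<in>{1..<n}. \<exists>I. I \<in> intervals n \<and> admissible n Q (fst I) (snd I) \<and>
      (\<forall>i\<in>{1..n}. arrow_weight Q j i = interval_weight Q (fst I) (snd I) i)"
    using arrow_weight_eq_interval_weight[OF Q] by fastforce
  then obtain I where I: "\<And>j. j \<in> {1..<n} \<Longrightarrow> I j \<in> intervals n"
      "\<And>j. j \<in> {1..<n} \<Longrightarrow> admissible n Q (fst (I j)) (snd (I j))"
      "\<And>j i. j \<in> {1..<n} \<Longrightarrow> i \<in> {1..n} \<Longrightarrow>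
        arrow_weight Q j i = interval_weight Q (fst (I j)) (snd (I j)) i"
    by metis
  define c where "c r = (\<Sum>j | j \<in> {1..<n} \<and> I j = r. j * (n - j))" for r
  show thesis
  proof
    fix i assume i: "i \<in> {1..n}"
    have "intrinsic_weight n Q i = (\<Sum>j=1..<n. int (j * (n - j)) * arrow_weight Q j i)"
      using intrinsic_weight_eq_sum_arrows[OF Q] i by simp
    also have "\<dots> = (\<Sum>r\<in>intervals n. \<Sum>j | j \<in> {1..<n} \<and> I j = r.
        int (j * (n - j)) * arrow_weight Q j i)"
      using I(1) by (intro sum.group[symmetric]) auto
    also have "\<dots> = (\<Sum>r\<in>intervals n. int (c r) * interval_weight Q (fst r) (snd r) i)"
      using I(3) i by (intro sum.cong refl) (auto simp: c_def sum_distrib_right)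
    finally show "intrinsic_weight n Q i =
        (\<Sum>(p, q)\<in>intervals n. int (c (p, q)) * interval_weight Q p q i)"
      by (simp add: case_prod_unfold)
  next
    fix p q assume "\<not> admissible n Q p q"
    then have "{j. j \<in> {1..<n} \<and> I j = (p, q)} = {}"
      using I(2) by fastforce
    then show "c (p, q) = 0"
      unfolding c_def by (simp only: sum.empty)
  qed
qed

section \<open>Reversing the arrows\<close>

definition opposite :: "('a, 'b) pre_digraph \<Rightarrow> ('a, 'b) pre_digraph" where
  "opposite Q = \<lparr>verts = verts Q, arcs = arcs Q, tail = head Q, head = tail Q\<rparr>"

lemma type_A_quiver_opposite: "type_A_quiver n Q \<Longrightarrow> type_A_quiver n (opposite Q)"
  by (auto simp: type_A_quiver_def opposite_def wf_digraph_def insert_commute)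

lemma type_opposite:
  "type_I (opposite Q) = type_II Q" "type_II (opposite Q) = type_I Q"
  "type_III (opposite Q) = type_IV Q" "type_IV (opposite Q) = type_III Q"
  by (auto simp: fun_eq_iff type_I_def type_II_def type_III_def type_IV_def opposite_def
      arcs_ends_conv image_iff)

text \<open>
  The bounds on \<open>p\<close> and \<open>q\<close> rule out an isolated vertex strictly between \<open>p\<close> and \<open>q\<close>; it would
  be of both types I and II, and both weight systems would resolve the tie in favour of type I.
\<close>

lemma interval_weight_opposite:
  assumes Q: "type_A_quiver n Q" and "1 \<le> p" "q \<le> n"
  shows "interval_weight (opposite Q) p q i = - interval_weight' Q p q i"
proof -
  have "\<not> (type_I Q i \<and> type_II Q i)" if "p < i" "i < q"
    using that assms type_I_iff[OF Q, of i] type_II_iff[OF Q, of i] by auto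
  then show ?thesis
    by (auto simp: interval_weight_def interval_weight'_def type_opposite)
qed

lemma intrinsic_weight_opposite:
  assumes Q: "type_A_quiver n Q" and i: "1 \<le> i" "i \<le> n"
  shows "intrinsic_weight n (opposite Q) i = - intrinsic_weight n Q i"
  using i unfolding intrinsic_weight_def Let_def type_opposite
  by (auto simp: type_I_iff[OF Q i] type_II_iff[OF Q i] type_III_iff[OF Q i]
      type_IV_iff[OF Q i])

lemma admissible_opposite: "admissible n (opposite Q) p q \<longleftrightarrow> admissible' n Q p q"
  unfolding admissible_def admissible'_def type_opposite by auto

lemma intrinsic_weight_eq_sum_interval_weight':
  assumes Q: "type_A_quiver n Q"
  obtains c :: "nat \<times> nat \<Rightarrow> nat" where
    "\<And>i. i \<in> {1..n} \<Longrightarrow> intrinsic_weight n Q i =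
       (\<Sum>(p, q)\<in>intervals n. int (c (p, q)) * interval_weight' Q p q i)"
    "\<And>p q. \<not> admissible' n Q p q \<Longrightarrow> c (p, q) = 0"
proof -
  obtain c :: "nat \<times> nat \<Rightarrow> nat" where c:
    "\<And>i. i \<in> {1..n} \<Longrightarrow> intrinsic_weight n (opposite Q) i =
       (\<Sum>(p, q)\<in>intervals n. int (c (p, q)) * interval_weight (opposite Q) p q i)"
    "\<And>p q. \<not> admissible n (opposite Q) p q \<Longrightarrow> c (p, q) = 0"
    using intrinsic_weight_eq_sum_interval_weight[OF type_A_quiver_opposite[OF Q]] by blast
  show thesis
  proof
    fix i assume i: "i \<in> {1..n}"
    have "- intrinsic_weight n Q i =
        (\<Sum>(p, q)\<in>intervals n. int (c (p, q)) * interval_weight (opposite Q) p q i)"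
      using c(1)[OF i] intrinsic_weight_opposite[OF Q] i by simp
    also have "\<dots> = (\<Sum>(p, q)\<in>intervals n. - (int (c (p, q)) * interval_weight' Q p q i))"
      by (intro sum.cong refl) (auto simp: interval_weight_opposite[OF Q] intervals_def)
    finally show "intrinsic_weight n Q i =
        (\<Sum>(p, q)\<in>intervals n. int (c (p, q)) * interval_weight' Q p q i)"
      by (simp add: case_prod_unfold sum_negf)
  qed (use c(2) admissible_opposite in blast)
qed

lemma sum_intervals_restrict:
  assumes "\<And>p q. \<not> A p q \<Longrightarrow> c (p, q) = (0::nat)"
  shows "(\<Sum>(p, q)\<in>{(p, q)\<in>intervals n. A p q}. int (c (p, q)) * w p q) =
    (\<Sum>(p, q)\<in>intervals n. int (c (p, q)) * w p q)"
proof (rule sum.mono_neutral_left)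
  show "\<forall>r\<in>intervals n - {(p, q)\<in>intervals n. A p q}.
      (case r of (p, q) \<Rightarrow> int (c (p, q)) * w p q) = 0"
    using assms by fastforce
qed auto

theorem proposition3p10:
  fixes n :: nat and Q :: "(nat, 'b) pre_digraph"
  assumes "type_A_quiver n Q"
  shows
    "((\<exists>c :: nat \<times> nat \<Rightarrow> nat. \<forall>i\<in>{1..n}.
         intrinsic_weight n Q i =
           (\<Sum>(p, q)\<in>intervals n. int (c (p, q)) * interval_weight Q p q i)) \<and>
      (\<exists>c :: nat \<times> nat \<Rightarrow> nat. \<forall>i\<in>{1..n}.
         intrinsic_weight n Q i =
           (\<Sum>(p, q)\<in>{(p, q)\<in>intervals n. admissible n Q p q}.
              int (c (p, q)) * interval_weight Q p q i))) \<and>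
     ((\<exists>c' :: nat \<times> nat \<Rightarrow> nat. \<forall>i\<in>{1..n}.
         intrinsic_weight n Q i =
           (\<Sum>(p, q)\<in>intervals n. int (c' (p, q)) * interval_weight' Q p q i)) \<and>
      (\<exists>c' :: nat \<times> nat \<Rightarrow> nat. \<forall>i\<in>{1..n}.
         intrinsic_weight n Q i =
           (\<Sum>(p, q)\<in>{(p, q)\<in>intervals n. admissible' n Q p q}.
              int (c' (p, q)) * interval_weight' Q p q i)))"
proof -
  obtain c where c:
    "\<And>i. i \<in> {1..n} \<Longrightarrow> intrinsic_weight n Q i =
       (\<Sum>(p, q)\<in>intervals n. int (c (p, q)) * interval_weight Q p q i)"
    "\<And>p q. \<not> admissible n Q p q \<Longrightarrow> c (p, q) = 0"
    using intrinsic_weight_eq_sum_interval_weight[OF assms] by blast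
  obtain c' where c':
    "\<And>i. i \<in> {1..n} \<Longrightarrow> intrinsic_weight n Q i =
       (\<Sum>(p, q)\<in>intervals n. int (c' (p, q)) * interval_weight' Q p q i)"
    "\<And>p q. \<not> admissible' n Q p q \<Longrightarrow> c' (p, q) = 0"
    using intrinsic_weight_eq_sum_interval_weight'[OF assms] by blast
  have restricted: "\<forall>i\<in>{1..n}. intrinsic_weight n Q i =
      (\<Sum>(p, q)\<in>{(p, q)\<in>intervals n. admissible n Q p q}.
         int (c (p, q)) * interval_weight Q p q i)"
    by (simp add: c(1) sum_intervals_restrict[of "admissible n Q" c, OF c(2)])
  have restricted': "\<forall>i\<in>{1..n}. intrinsic_weight n Q i =
      (\<Sum>(p, q)\<in>{(p, q)\<in>intervals n. admissible' n Q p q}.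
         int (c' (p, q)) * interval_weight' Q p q i)"
    by (simp add: c'(1) sum_intervals_restrict[of "admissible' n Q" c', OF c'(2)])
  show ?thesis
    using c(1) restricted c'(1) restricted' by blast
qed

end
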